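(* Let $n\ge 1$ be an integer. The group $\mathrm{Isom}\,\mathbb{S}_n$ (acting on $\mathbb{S}_n$) is fixating if and only if $n=1$. The group $\mathrm{Isom}^+\,\mathbb{S}_n$ (acting on $\mathbb{S}_n$) is fixating if and only if $n=1$ or $n=3$.
   Context: $\mathbb{S}_n$ is the unit sphere of $\mathbb{R}^{n+1}$ with the spherical distance $d(x,y)=\arccos\langle x\,|\,y\rangle$. $\mathrm{Isom}\,\mathbb{S}_n$ is the group of isometries (distance-preserving bijections) of $\mathbb{S}_n$; these are exactly the restrictions to $\mathbb{S}_n$ of elements of the orthogonal group $\mathrm{O}_{n+1}$. $\mathrm{Isom}^+\,\mathbb{S}_n$ is the subgroup of orientation-preserving isometries, i.e. the restrictions of elements of $\mathrm{SO}_{n+1}$. For a bijection $g$ of a set $X$, $\mathrm{Fix}\,g=\{x\in X: g(x)=x\}$. A group $H$ of bijections of $X$ is a GAF if $\mathrm{Fix}\,g\neq\emptyset$ for every $g\in H$; it is a GAG if $\bigcap_{g\in H}\mathrm{Fix}\,g\ne\emptyset$. A group $G$ of bijections of $X$ is fixating if every subgroup of $G$ that is a GAF is a GAG. *)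

theory Defs
  imports "HOL-Analysis.Analysis" "HOL-Algebra.Bij"
begin

text \<open>
  Groups of bijections of a set \<open>X\<close> are the subgroups of the library's \<^const>\<open>BijGroup\<close> of \<open>X\<close>,
  whose elements are functions that are \<^const>\<open>undefined\<close> outside \<open>X\<close>; hence distinct elements
  already differ on \<open>X\<close>, and a map given on the whole space enters as its \<^const>\<open>restrict\<close> to \<open>X\<close>.
\<close>

definition Fix :: "'a set \<Rightarrow> ('a \<Rightarrow> 'a) \<Rightarrow> 'a set" where
  "Fix X g = {x \<in> X. g x = x}"

definition GAF :: "'a set \<Rightarrow> ('a \<Rightarrow> 'a) set \<Rightarrow> bool" where
  "GAF X H \<longleftrightarrow> subgroup H (BijGroup X) \<and> (\<forall>g\<in>H. Fix X g \<noteq> {})"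

definition GAG :: "'a set \<Rightarrow> ('a \<Rightarrow> 'a) set \<Rightarrow> bool" where
  "GAG X H \<longleftrightarrow> subgroup H (BijGroup X) \<and> (\<Inter>g\<in>H. Fix X g) \<noteq> {}"

definition fixating :: "'a set \<Rightarrow> ('a \<Rightarrow> 'a) set \<Rightarrow> bool" where
  "fixating X G \<longleftrightarrow> subgroup G (BijGroup X) \<and>
     (\<forall>H. subgroup H (BijGroup X\<lparr>carrier := G\<rparr>) \<longrightarrow> GAF X H \<longrightarrow> GAG X H)"

definition isometries :: "'a set \<Rightarrow> ('a \<Rightarrow> 'a \<Rightarrow> real) \<Rightarrow> ('a \<Rightarrow> 'a) set" where
  "isometries X d = {g \<in> Bij X. \<forall>x\<in>X. \<forall>y\<in>X. d (g x) (g y) = d x y}"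

text \<open>
  \<open>\<S>\<close> is the unit sphere of the Euclidean space with coordinates indexed by \<open>'n\<close>; it has
  dimension \<open>CARD('n) - 1\<close>.
\<close>

abbreviation unit_sphere :: "(real ^ 'n) set" (\<open>\<S>\<close>) where
  "\<S> \<equiv> sphere 0 1"

definition spherical_dist :: "real ^ 'n \<Rightarrow> real ^ 'n \<Rightarrow> real" where
  "spherical_dist x y = arccos (x \<bullet> y)"

definition Isom_sphere :: "(real ^ 'n \<Rightarrow> real ^ 'n) set" where
  "Isom_sphere = isometries \<S> spherical_dist"

definition Isom_plus_sphere :: "(real ^ 'n \<Rightarrow> real ^ 'n) set" where
  "Isom_plus_sphere = {restrict ((*v) A) \<S> | A. rotation_matrix A}"

lemma spherical_dist_eq_iff:
  fixes x y u v :: "real ^ 'n"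
  assumes "x \<in> \<S>" "y \<in> \<S>" "u \<in> \<S>" "v \<in> \<S>"
  shows "spherical_dist x y = spherical_dist u v \<longleftrightarrow> x \<bullet> y = u \<bullet> v"
proof -
  have "\<bar>x \<bullet> y\<bar> \<le> 1" "\<bar>u \<bullet> v\<bar> \<le> 1"
    using Cauchy_Schwarz_ineq2[of x y] Cauchy_Schwarz_ineq2[of u v] assms by simp_all
  then show ?thesis
    unfolding spherical_dist_def by (metis arccos_eq_iff)
qed

lemma restrict_orthogonal_in_Isom_sphere:
  fixes A :: "real ^ 'n ^ 'n"
  assumes "orthogonal_matrix A"
  shows "restrict ((*v) A) \<S> \<in> Isom_sphere"
proof -
  have orth: "orthogonal_transformation ((*v) A)"
    using assms by (simp add: orthogonal_transformation_matrix)
  then have inner: "(A *v x) \<bullet> (A *v y) = x \<bullet> y" for x y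
    by (simp add: orthogonal_transformation_def)
  have nrm: "norm (A *v x) = norm x" for x
    by (simp add: norm_eq_sqrt_inner inner)
  have "bij_betw ((*v) A) \<S> \<S>"
  proof (rule bij_betw_imageI)
    show "inj_on ((*v) A) \<S>"
      using orthogonal_transformation_inj[OF orth] by (rule inj_on_subset) simp
    show "(*v) A ` \<S> = \<S>"
    proof (intro equalityI subsetI)
      fix y :: "real ^ 'n" assume "y \<in> \<S>"
      moreover obtain x where "y = A *v x"
        using orthogonal_transformation_surj[OF orth] by (metis surjD)
      ultimately show "y \<in> (*v) A ` \<S>"
        using nrm by auto
    qed (auto simp: nrm)
  qed
  then show ?thesis
    by (simp add: Isom_sphere_def isometries_def Bij_def spherical_dist_def inner)
qed

lemma Isom_sphere_eq:
  "Isom_sphere = {restrict ((*v) A) \<S> | A :: real ^ 'n ^ 'n. orthogonal_matrix A}"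
proof (intro equalityI subsetI)
  fix g :: "real ^ 'n \<Rightarrow> real ^ 'n" assume "g \<in> Isom_sphere"
  then have bij: "bij_betw g \<S> \<S>" and ext: "g \<in> extensional \<S>"
    and iso: "\<And>x y. \<lbrakk>x \<in> \<S>; y \<in> \<S>\<rbrakk> \<Longrightarrow> spherical_dist (g x) (g y) = spherical_dist x y"
    by (auto simp: Isom_sphere_def isometries_def Bij_def)
  have into: "g x \<in> \<S>" if "x \<in> \<S>" for x
    using bij that by (rule bij_betw_apply)
  have inner: "g x \<bullet> g y = x \<bullet> y" if "x \<in> \<S>" "y \<in> \<S>" for x y
    using iso[OF that] spherical_dist_eq_iff[OF into into that, OF that] by blast
  have "dist (g x) (g y) = dist x y" if "x \<in> \<S>" "y \<in> \<S>" for x y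
    using that by (simp add: dist_norm norm_eq_sqrt_inner inner_diff inner)
  then have "\<exists>h. orthogonal_transformation h \<and> (\<forall>x. norm x = 1 \<longrightarrow> h x = g x)"
    using into by (intro isometry_sphere_extend) simp_all
  then obtain h where h: "orthogonal_transformation h" "\<And>x. x \<in> \<S> \<Longrightarrow> h x = g x"
    by auto
  then have lin: "linear h" and "orthogonal_matrix (matrix h)"
    by (simp_all add: orthogonal_transformation_matrix)
  moreover have "g = restrict ((*v) (matrix h)) \<S>"
    by (rule extensionalityI[OF ext restrict_extensional]) (simp add: h(2) matrix_works lin)
  ultimately show "g \<in> {restrict ((*v) A) \<S> | A. orthogonal_matrix A}"
    by blast
qed (auto intro: restrict_orthogonal_in_Isom_sphere)

lemma Isom_plus_sphere_subset: "Isom_plus_sphere \<subseteq> (Isom_sphere :: (real ^ 'n \<Rightarrow> real ^ 'n) set)"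
  by (auto simp: Isom_plus_sphere_def rotation_matrix_def intro: restrict_orthogonal_in_Isom_sphere)

lemma subgroup_restrict_matrices:
  fixes P :: "real ^ 'n ^ 'n \<Rightarrow> bool"
  assumes orth: "\<And>A. P A \<Longrightarrow> orthogonal_matrix A"
    and one: "P (mat 1)"
    and mult: "\<And>A B. P A \<Longrightarrow> P B \<Longrightarrow> P (A ** B)"
    and inv: "\<And>A. P A \<Longrightarrow> P (transpose A)"
  shows "subgroup {restrict ((*v) A) \<S> | A. P A} (BijGroup \<S>)"
    (is "subgroup ?G _")
proof -
  interpret group "BijGroup (\<S> :: (real ^ 'n) set)" by (rule group_BijGroup)
  have bij: "restrict ((*v) A) \<S> \<in> Bij \<S>" if "P A" for A
    using restrict_orthogonal_in_Isom_sphere[OF orth[OF that]]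
    by (simp add: Isom_sphere_def isometries_def)
  have into: "A *v x \<in> \<S>" if "P A" "x \<in> \<S>" for A x
    using Bij_imp_funcset[OF bij[OF that(1)]] that(2) by (auto simp: Pi_iff)
  have prod: "restrict ((*v) A) \<S> \<otimes>\<^bsub>BijGroup \<S>\<^esub> restrict ((*v) B) \<S> = restrict ((*v) (A ** B)) \<S>"
    if "P A" "P B" for A B
    using that bij into
    by (auto simp: BijGroup_def compose_def fun_eq_iff restrict_def matrix_vector_mul_assoc)
  have unit: "\<one>\<^bsub>BijGroup \<S>\<^esub> = restrict ((*v) (mat 1)) (\<S> :: (real ^ 'n) set)"
    by (simp add: BijGroup_def restrict_def fun_eq_iff)
  show ?thesis
  proof (rule subgroupI)
    show "?G \<subseteq> carrier (BijGroup \<S>)" using bij by (auto simp: BijGroup_def)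
    show "?G \<noteq> {}" using one by blast
    show "a \<otimes>\<^bsub>BijGroup \<S>\<^esub> b \<in> ?G" if "a \<in> ?G" "b \<in> ?G" for a b
      using that prod mult by blast
    show "inv\<^bsub>BijGroup \<S>\<^esub> a \<in> ?G" if "a \<in> ?G" for a
    proof -
      obtain A where A: "a = restrict ((*v) A) \<S>" "P A" using \<open>a \<in> ?G\<close> by blast
      have "restrict ((*v) (transpose A)) \<S> \<otimes>\<^bsub>BijGroup \<S>\<^esub> a = \<one>\<^bsub>BijGroup \<S>\<^esub>"
        using A inv orth[OF A(2)] by (simp only: prod unit orthogonal_matrix)
      then have "inv\<^bsub>BijGroup \<S>\<^esub> a = restrict ((*v) (transpose A)) \<S>"
        using A bij inv by (intro inv_equality) (auto simp: BijGroup_def)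
      then show ?thesis using A inv by blast
    qed
  qed
qed

lemma subgroup_Isom_sphere: "subgroup Isom_sphere (BijGroup (\<S> :: (real ^ 'n) set))"
  unfolding Isom_sphere_eq
  by (rule subgroup_restrict_matrices) (auto simp: orthogonal_matrix_id orthogonal_matrix_mul)

lemma subgroup_Isom_plus_sphere: "subgroup Isom_plus_sphere (BijGroup (\<S> :: (real ^ 'n) set))"
  unfolding Isom_plus_sphere_def
  by (rule subgroup_restrict_matrices)
    (auto simp: rotation_matrix_def orthogonal_matrix_id orthogonal_matrix_mul det_mul)

end

theory Submission
  imports Defs
begin

text \<open>
  Every isometry of the sphere is given by an orthogonal matrix, so the question is whether
  orthogonal matrices that each fix a nonzero vector, and whose products do so as well, must fix
  a common nonzero vector.  Write \<open>F A\<close> for the fixed space of \<open>A\<close>, and \<open>N\<close> for the number of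
  coordinates, so that the sphere has dimension \<open>N - 1\<close>.

  The counterexamples all come from the Klein four-group, whose three nontrivial characters
  have the property that every group element lies in the kernel of at least one of them.  Let it
  act by diagonal sign matrices in which each of these characters occurs, and no other.  Then
  every element fixes a coordinate axis, but no nonzero vector is fixed by all.  This needs only
  \<open>N \<ge> 3\<close>.  The determinants are \<open>1\<close> as soon as the three multiplicities have the same parity,
  which can be arranged as \<open>1, 1, N - 2\<close> for odd \<open>N\<close> and as \<open>2, 2, N - 4\<close> for even \<open>N \<ge> 6\<close>.  For
  \<open>N = 4\<close> it cannot be arranged.

  The positive results rest on \<open>fixed_by_factors\<close>: a vector of \<open>F A + F B\<close> that is fixed by the
  product \<open>A ** B\<close> is fixed by both factors.  Hence \<open>F A\<close> and \<open>F B\<close> intersect nontrivially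
  whenever their dimensions add up to at least \<open>N\<close> and \<open>A ** B\<close> fixes a nonzero vector
  (\<open>fixed_spaces_meet\<close>).  For \<open>N = 2\<close> the fixed spaces of the nontrivial matrices are lines, which
  therefore coincide.

  For rotations with \<open>N = 4\<close>, a parity argument (\<open>det_eq_fixed_space\<close>) shows that the fixed spaces
  of the nontrivial matrices are planes, and any two of them intersect nontrivially.  Unless all
  the planes coincide, two of them, \<open>F A\<close> and \<open>F B\<close>, meet in a line \<open>L\<close>.  If some \<open>F C\<close> did not contain \<open>L\<close>,
  it would meet \<open>F A\<close> and \<open>F B\<close> in two different lines and so be contained in \<open>F A + F B\<close>.  But \<open>F C\<close>
  also contains a nonzero vector of \<open>F (A ** B)\<close>; being in \<open>F A + F B\<close>, this vector is fixed by \<open>A\<close>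
  and \<open>B\<close>, so it spans \<open>L\<close>, a contradiction.  Thus all the matrices fix \<open>L\<close>.
\<close>

section \<open>Fixed spaces of orthogonal matrices\<close>

definition fixed_space :: "real ^ 'n ^ 'n \<Rightarrow> (real ^ 'n) set" where
  "fixed_space A = {x. A *v x = x}"

lemma mem_fixed_space [simp]: "x \<in> fixed_space A \<longleftrightarrow> A *v x = x"
  by (simp add: fixed_space_def)

lemma subspace_fixed_space [simp]: "subspace (fixed_space A)"
  by (simp add: subspace_def matrix_vector_right_distrib matrix_vector_mult_scaleR)

lemma fixed_space_eq_UNIV_iff: "fixed_space A = UNIV \<longleftrightarrow> A = mat 1"
  by (metis UNIV_I UNIV_eq_I matrix_eq matrix_vector_mul_lid mem_fixed_space)

lemma orthogonal_matrix_inner: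
  fixes A :: "real ^ 'n ^ 'n"
  assumes "orthogonal_matrix A"
  shows "(A *v x) \<bullet> (A *v y) = x \<bullet> y"
  using assms by (metis matrix_of_matrix_vector_mul matrix_vector_mul_linear
    orthogonal_transformation_def orthogonal_transformation_matrix)

text \<open>
  The reflection is obtained from the one that negates a coordinate axis by conjugation with an
  orthogonal matrix that moves this axis to the direction of \<open>w\<close>; this makes the determinant
  visible.
\<close>

lemma ex_reflection:
  fixes w :: "real ^ 'n"
  assumes "w \<noteq> 0"
  obtains R where "orthogonal_matrix R" "det R = - 1"
    "\<And>x. R *v x = x - (2 * (x \<bullet> w) / (w \<bullet> w)) *\<^sub>R w"
proof -
  define k :: 'n where "k = undefined"
  define a where "a = w /\<^sub>R norm w"
  have "norm a = 1" using assms by (simp add: a_def)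
  then obtain Q where Q: "orthogonal_matrix Q" "Q *v axis k 1 = a"
    by (rule orthogonal_matrix_exists_basis)
  define D :: "real ^ 'n ^ 'n" where "D = (\<chi> i j. if i = j then (if i = k then -1 else 1) else 0)"
  have D: "D *v y = y - (2 * (y \<bullet> axis k 1)) *\<^sub>R axis k 1" for y
    by (simp add: vec_eq_iff D_def matrix_vector_mult_def inner_axis)
      (simp add: axis_def if_distrib[of "\<lambda>c. c * _"] cong: if_cong)
  have detD: "det D = -1"
    by (subst det_diagonal) (simp_all add: D_def prod.If_cases Int_def)
  have oD: "orthogonal_matrix D"
    unfolding orthogonal_matrix by (simp add: vec_eq_iff D_def matrix_matrix_mult_def transpose_def
        mat_def if_distrib[of "\<lambda>c. c * _"] cong: if_cong)
  define R where "R = Q ** D ** transpose Q"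
  have QQ: "Q ** transpose Q = mat 1" using Q(1) by (simp add: orthogonal_matrix_def)
  have "R *v x = x - (2 * (x \<bullet> a)) *\<^sub>R a" for x
  proof -
    have "(transpose Q *v x) \<bullet> axis k 1 = x \<bullet> a"
      by (simp add: Q(2)[symmetric] dot_lmul_matrix)
    then have "R *v x = Q *v (transpose Q *v x) - (2 * (x \<bullet> a)) *\<^sub>R a"
      by (simp add: R_def D Q(2) matrix_vector_mul_assoc[symmetric] matrix_vector_mult_diff_distrib
          matrix_vector_mult_scaleR del: transpose_matrix_vector)
    then show ?thesis by (simp only: matrix_vector_mul_assoc QQ matrix_vector_mul_lid)
  qed
  moreover have "(2 * (x \<bullet> a)) *\<^sub>R a = (2 * (x \<bullet> w) / (w \<bullet> w)) *\<^sub>R w" for x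
    using assms by (simp add: a_def dot_square_norm power2_eq_square divide_simps)
  moreover have "orthogonal_matrix R"
    by (simp add: R_def orthogonal_matrix_mul Q oD)
  moreover have "det R = -1"
    using det_orthogonal_matrix[OF Q(1)] by (auto simp: R_def det_mul detD det_transpose)
  ultimately show thesis by (intro that) auto
qed

text \<open>
  This is the step in the proof of the Cartan--Dieudonne theorem: if \<open>A\<close> moves \<open>z\<close>, then following
  \<open>A\<close> by the reflection that takes \<open>A *v z\<close> back to \<open>z\<close> enlarges the fixed space by exactly the
  direction of \<open>z\<close> and changes the sign of the determinant.
\<close>

lemma det_eq_fixed_space:
  fixes A :: "real ^ 'n ^ 'n"
  assumes "orthogonal_matrix A"
  shows "det A = (- 1) ^ (CARD('n) - dim (fixed_space A))"
  using assms
proof (induction "CARD('n) - dim (fixed_space A)" arbitrary: A rule: less_induct)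
  case less
  show ?case
  proof (cases "A = mat 1")
    case True
    then have "fixed_space A = UNIV" by (simp add: fixed_space_eq_UNIV_iff)
    then show ?thesis using True by simp
  next
    case False
    then obtain z where z: "A *v z \<noteq> z"
      by (metis matrix_eq matrix_vector_mul_lid)
    define w where "w = A *v z - z"
    have "w \<noteq> 0" using z by (simp add: w_def)
    then obtain R where R: "orthogonal_matrix R" "det R = - 1"
      "\<And>x. R *v x = x - (2 * (x \<bullet> w) / (w \<bullet> w)) *\<^sub>R w"
      by (rule ex_reflection) blast
    define B where "B = R ** A"
    have oB: "orthogonal_matrix B" by (simp add: B_def R less.prems orthogonal_matrix_mul)
    have B: "B *v x = A *v x - (2 * ((A *v x) \<bullet> w) / (w \<bullet> w)) *\<^sub>R w" for x
      by (simp add: B_def matrix_vector_mul_assoc[symmetric] R)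
    have ww: "w \<bullet> w = - 2 * (z \<bullet> w)" "w \<bullet> w = 2 * ((A *v z) \<bullet> w)"
      using orthogonal_matrix_inner[OF less.prems, of z z]
      by (simp_all add: w_def inner_diff inner_commute)
    have Bz: "B *v z = z"
    proof -
      have "2 * ((A *v z) \<bullet> w) / (w \<bullet> w) = 1"
        using \<open>w \<noteq> 0\<close> by (simp add: ww(2)[symmetric])
      then show ?thesis by (simp only: B) (simp add: w_def)
    qed
    have perp: "x \<bullet> w = 0" if "A *v x = x" for x
      using orthogonal_matrix_inner[OF less.prems, of x z] that by (simp add: w_def inner_diff)
    have FB: "fixed_space B = span (insert z (fixed_space A))"
    proof (intro equalityI subsetI)
      fix x assume "x \<in> fixed_space B"
      \<comment> \<open>Subtract the multiple of \<open>z\<close> that makes \<open>x\<close> orthogonal to \<open>w\<close>: on fixed vectors of \<open>B\<close>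
        orthogonal to \<open>w\<close>, the reflection acts trivially.\<close>
      define c where "c = (x \<bullet> w) / (z \<bullet> w)"
      define y where "y = x - c *\<^sub>R z"
      have yw: "y \<bullet> w = 0"
        using \<open>w \<noteq> 0\<close> ww(1) by (auto simp: y_def c_def inner_diff)
      have "B *v y = y"
        using \<open>x \<in> fixed_space B\<close> Bz
        by (simp add: y_def matrix_vector_mult_diff_distrib matrix_vector_mult_scaleR)
      then have Ay: "A *v y = y + (2 * ((A *v y) \<bullet> w) / (w \<bullet> w)) *\<^sub>R w"
        by (simp add: B algebra_simps)
      have "(A *v y) \<bullet> w = y \<bullet> w + 2 * ((A *v y) \<bullet> w)"
        using \<open>w \<noteq> 0\<close> by (subst Ay) (simp add: inner_add_left)
      then have "(A *v y) \<bullet> w = 0" using yw by simp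
      then have "y \<in> fixed_space A" using Ay by simp
      then have "y + c *\<^sub>R z \<in> span (insert z (fixed_space A))"
        by (intro span_add span_scale span_base) auto
      then show "x \<in> span (insert z (fixed_space A))" by (simp add: y_def)
    next
      fix x assume "x \<in> span (insert z (fixed_space A))"
      moreover have "insert z (fixed_space A) \<subseteq> fixed_space B"
        using Bz perp by (auto simp: B)
      ultimately show "x \<in> fixed_space B"
        using span_minimal subspace_fixed_space by blast
    qed
    have "z \<notin> span (fixed_space A)"
      using z by (simp add: span_eq_iff[THEN iffD2])
    then have dimB: "dim (fixed_space B) = dim (fixed_space A) + 1"
      by (simp add: FB dim_insert)
    moreover have "dim (fixed_space B) \<le> CARD('n)"
      by (rule dim_subset_UNIV_cart)
    moreover have "det B = (- 1) ^ (CARD('n) - dim (fixed_space B))"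
      using oB calculation by (intro less.hyps) auto
    moreover have "det B = - det A" by (simp add: B_def det_mul R)
    ultimately have "- det A = (- 1) ^ (CARD('n) - Suc (dim (fixed_space A)))"
      and "CARD('n) - dim (fixed_space A) = Suc (CARD('n) - Suc (dim (fixed_space A)))"
      by simp_all
    then show ?thesis by simp
  qed
qed

lemma dim_pos_iff:
  fixes S :: "(real ^ 'n) set"
  shows "dim S > 0 \<longleftrightarrow> (\<exists>x\<in>S. x \<noteq> 0)"
  using dim_eq_0[of S] by (auto simp del: dim_eq_0)

lemma subspace_eq_UNIV:
  fixes S :: "(real ^ 'n) set"
  assumes "subspace S" "dim S = CARD('n)"
  shows "S = UNIV"
  using assms by (intro subspace_dim_equal) auto

lemma line_subset_of_meet:
  fixes S T :: "(real ^ 'n) set"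
  assumes "subspace S" "subspace T" "dim S = 1" "dim (S \<inter> T) > 0"
  shows "S \<subseteq> T"
proof -
  have "S \<inter> T = S"
    using assms by (intro subspace_dim_equal subspace_inter) auto
  then show ?thesis by blast
qed

section \<open>Fixed vectors of a product\<close>

text \<open>
  If \<open>A *v (B *v x) = x\<close>, then \<open>B *v x\<close> and \<open>x\<close> have the same inner product with every vector
  fixed by \<open>A\<close>, since \<open>A\<close> maps the one to the other, and with every vector fixed by \<open>B\<close>, for the
  same reason.  So \<open>B *v x - x\<close> is orthogonal to \<open>x\<close>, and as \<open>B *v x\<close> and \<open>x\<close> have equal norms this
  difference vanishes.
\<close>

lemma fixed_by_factors:
  fixes A B :: "real ^ 'n ^ 'n"
  assumes "orthogonal_matrix A" "orthogonal_matrix B"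
    and "x \<in> fixed_space (A ** B)"
    and "x \<in> {y + z | y z. y \<in> fixed_space A \<and> z \<in> fixed_space B}"
  shows "x \<in> fixed_space A \<inter> fixed_space B"
proof -
  obtain y z where yz: "A *v y = y" "B *v z = z" "x = y + z"
    using assms(4) by auto
  have AB: "A *v (B *v x) = x" using assms(3) by (simp add: matrix_vector_mul_assoc)
  have "(B *v x) \<bullet> y = x \<bullet> y"
    using orthogonal_matrix_inner[OF assms(1), of "B *v x" y] AB yz by simp
  moreover have "(B *v x) \<bullet> z = x \<bullet> z"
    using orthogonal_matrix_inner[OF assms(2), of x z] yz by simp
  ultimately have "(B *v x) \<bullet> x = x \<bullet> x" by (simp add: yz(3) inner_add_right)
  then have "(B *v x - x) \<bullet> (B *v x - x) = 0"
    using orthogonal_matrix_inner[OF assms(2), of x x]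
    by (simp add: inner_diff inner_commute)
  then have "B *v x = x" by simp
  then show ?thesis using AB by simp
qed

text \<open>
  Otherwise the two fixed spaces would span the whole space, and by the preceding lemma the
  nonzero vectors fixed by \<open>A ** B\<close> would lie in their trivial intersection.
\<close>

lemma fixed_spaces_meet:
  fixes A B :: "real ^ 'n ^ 'n"
  assumes "orthogonal_matrix A" "orthogonal_matrix B"
    and "dim (fixed_space (A ** B)) > 0"
    and "CARD('n) \<le> dim (fixed_space A) + dim (fixed_space B)"
  shows "dim (fixed_space A \<inter> fixed_space B) > 0"
proof (rule ccontr)
  assume "\<not> ?thesis"
  then have 0: "dim (fixed_space A \<inter> fixed_space B) = 0" by simp
  let ?S = "{y + z | y z. y \<in> fixed_space A \<and> z \<in> fixed_space B}"
  have "dim ?S = dim (fixed_space A) + dim (fixed_space B)"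
    using dim_sums_Int[of "fixed_space A" "fixed_space B"] 0 by simp
  then have "dim ?S = CARD('n)"
    using assms(4) dim_subset_UNIV_cart[of ?S] by simp
  moreover have "subspace ?S" by (intro subspace_sums) auto
  ultimately have "?S = UNIV"
    by (intro subspace_eq_UNIV)
  then have "fixed_space (A ** B) \<subseteq> fixed_space A \<inter> fixed_space B"
    using fixed_by_factors[OF assms(1,2)] by blast
  then show False using assms(3) 0 dim_subset by (metis le_zero_eq less_numeral_extra(3))
qed

section \<open>Common fixed vectors in dimensions two and four\<close>

lemma common_fixed_vector_dim2:
  fixes M :: "(real ^ 'n ^ 'n) set"
  assumes "CARD('n) = 2"
    and orth: "\<And>A. A \<in> M \<Longrightarrow> orthogonal_matrix A"
    and mult: "\<And>A B. A \<in> M \<Longrightarrow> B \<in> M \<Longrightarrow> A ** B \<in> M"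
    and fixed: "\<And>A. A \<in> M \<Longrightarrow> dim (fixed_space A) > 0"
  shows "\<exists>x. x \<noteq> 0 \<and> (\<forall>A\<in>M. A *v x = x)"
proof (cases "M \<subseteq> {mat 1}")
  case True
  then show ?thesis by (intro exI[of _ "axis undefined 1"]) auto
next
  case False
  then obtain A where A: "A \<in> M" "A \<noteq> mat 1" by blast
  have "dim (fixed_space A) = 1"
  proof -
    have "dim (fixed_space A) \<noteq> 2"
      using A(2) assms(1) by (metis fixed_space_eq_UNIV_iff subspace_eq_UNIV subspace_fixed_space)
    then show ?thesis
      using fixed[OF A(1)] dim_subset_UNIV_cart[of "fixed_space A"] assms(1) by simp
  qed
  moreover have "dim (fixed_space A \<inter> fixed_space B) > 0" if "B \<in> M" for B
    using that A orth mult assms(1) fixed[OF A(1)] fixed[OF that] fixed[OF mult[OF A(1) that]]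
    by (intro fixed_spaces_meet) auto
  ultimately have "fixed_space A \<subseteq> fixed_space B" if "B \<in> M" for B
    using that by (intro line_subset_of_meet) auto
  moreover obtain x where "x \<in> fixed_space A" "x \<noteq> 0"
    using fixed[OF A(1)] by (auto simp: dim_pos_iff)
  ultimately show ?thesis by (metis mem_fixed_space subsetD)
qed

text \<open>The codimension of the fixed space of a rotation is even.\<close>

lemma dim_fixed_space_rotation4:
  fixes A :: "real ^ 'n ^ 'n"
  assumes "CARD('n) = 4" "rotation_matrix A" "dim (fixed_space A) > 0" "A \<noteq> mat 1"
  shows "dim (fixed_space A) = 2"
proof -
  let ?d = "dim (fixed_space A)"
  have "?d \<noteq> 4"
    using assms(1,4) by (metis fixed_space_eq_UNIV_iff subspace_eq_UNIV subspace_fixed_space)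
  moreover have "?d \<le> 4" using dim_subset_UNIV_cart[of "fixed_space A"] assms(1) by simp
  moreover have "(- 1 :: real) ^ (4 - ?d) = 1"
    using det_eq_fixed_space[of A] assms(1,2) by (simp add: rotation_matrix_def)
  then have "even (4 - ?d)" by (simp add: minus_one_power_iff split: if_splits)
  ultimately show ?thesis using assms(3) by presburger
qed

text \<open>
  Closure under products is used twice: for pairs, it forces fixed planes to intersect
  nontrivially; applied to \<open>A ** B\<close> and a third matrix \<open>C\<close>, it excludes the configuration in which
  three planes meet pairwise in three different lines of a common three-dimensional subspace.
\<close>

lemma common_fixed_vector_dim4:
  fixes M :: "(real ^ 'n ^ 'n) set"
  assumes "CARD('n) = 4"
    and rot: "\<And>A. A \<in> M \<Longrightarrow> rotation_matrix A"
    and mult: "\<And>A B. A \<in> M \<Longrightarrow> B \<in> M \<Longrightarrow> A ** B \<in> M"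
    and fixed: "\<And>A. A \<in> M \<Longrightarrow> dim (fixed_space A) > 0"
  shows "\<exists>x. x \<noteq> 0 \<and> (\<forall>A\<in>M. A *v x = x)"
proof -
  have orth: "orthogonal_matrix A" if "A \<in> M" for A
    using rot[OF that] by (simp add: rotation_matrix_def)
  have dim2: "dim (fixed_space A) = 2" if "A \<in> M" "A \<noteq> mat 1" for A
    using that assms by (intro dim_fixed_space_rotation4) auto
  have dim_ge: "dim (fixed_space A) \<ge> 2" if "A \<in> M" for A
  proof (cases "A = mat 1")
    case True
    then have "fixed_space A = UNIV" by (simp add: fixed_space_eq_UNIV_iff)
    then show ?thesis using assms(1) by simp
  qed (use that dim2 in simp)
  have meet: "dim (fixed_space A \<inter> fixed_space B) > 0" if "A \<in> M" "B \<in> M" for A B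
    using that orth mult fixed assms(1) dim_ge[of A] dim_ge[of B]
    by (intro fixed_spaces_meet) auto
  show ?thesis
  proof (cases "\<exists>A\<in>M. \<exists>B\<in>M. A \<noteq> mat 1 \<and> B \<noteq> mat 1 \<and> fixed_space A \<noteq> fixed_space B")
    case False
    show ?thesis
    proof (cases "M \<subseteq> {mat 1}")
      case True
      then show ?thesis by (intro exI[of _ "axis undefined 1"]) auto
    next
      case nontriv: False
      then obtain A where A: "A \<in> M" "A \<noteq> mat 1" by blast
      obtain x where x: "A *v x = x" "x \<noteq> 0"
        using fixed[OF A(1)] by (auto simp: dim_pos_iff)
      have "B *v x = x" if "B \<in> M" for B
        using that A x False by (metis matrix_vector_mul_lid mem_fixed_space)
      then show ?thesis using x(2) by blast
    qed
  next
    case True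
    then obtain A B where AB: "A \<in> M" "B \<in> M" "A \<noteq> mat 1" "B \<noteq> mat 1"
      "fixed_space A \<noteq> fixed_space B" by blast
    define L where "L = fixed_space A \<inter> fixed_space B"
    have L: "subspace L" by (simp add: L_def subspace_inter)
    have "dim L \<noteq> 2"
    proof
      assume "dim L = 2"
      then have "L = fixed_space A" "L = fixed_space B"
        using L dim2[OF AB(1,3)] dim2[OF AB(2,4)]
        by (intro subspace_dim_equal; simp add: L_def)+
      then show False using AB(5) by simp
    qed
    moreover have "dim L \<le> 2"
      using dim2[OF AB(1,3)] dim_subset[of L "fixed_space A"] by (simp add: L_def)
    ultimately have dimL: "dim L = 1"
      using meet[OF AB(1,2)] by (simp add: L_def)
    have "L \<subseteq> fixed_space C" if C: "C \<in> M" for C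
    proof (rule ccontr)
      assume nsub: "\<not> L \<subseteq> fixed_space C"
      then have C1: "C \<noteq> mat 1" by (auto simp: fixed_space_eq_UNIV_iff[THEN iffD2])
      have LC0: "dim (L \<inter> fixed_space C) = 0"
        using nsub line_subset_of_meet[OF L _ dimL, of "fixed_space C"] by fastforce
      \<comment> \<open>The planes of \<open>A\<close> and \<open>B\<close> cut two independent lines out of the plane of \<open>C\<close>, which
        therefore lies in the sum of the planes of \<open>A\<close> and \<open>B\<close>.\<close>
      let ?U = "fixed_space A \<inter> fixed_space C" and ?V = "fixed_space B \<inter> fixed_space C"
      let ?S = "{y + z | y z. y \<in> ?U \<and> z \<in> ?V}"
      have sU: "subspace ?U" "subspace ?V" by (simp_all add: subspace_inter)
      have "?U \<inter> ?V = L \<inter> fixed_space C" by (auto simp: L_def)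
      then have "dim ?S = dim ?U + dim ?V"
        using dim_sums_Int[OF sU] LC0 by simp
      then have "dim ?S \<ge> 2"
        using meet[OF AB(1) C] meet[OF AB(2) C] by simp
      moreover have "?S \<subseteq> fixed_space C"
        by (auto simp: matrix_vector_right_distrib)
      ultimately have "?S = fixed_space C"
        using dim2[OF C C1] subspace_sums[OF sU] by (intro subspace_dim_equal) auto
      then have sub: "fixed_space C \<subseteq> {y + z | y z. y \<in> fixed_space A \<and> z \<in> fixed_space B}"
        by blast
      obtain x where x: "x \<in> fixed_space (A ** B)" "x \<in> fixed_space C" "x \<noteq> 0"
        using meet[OF mult[OF AB(1,2)] C] by (auto simp: dim_pos_iff)
      have "x \<in> L"
        unfolding L_def using AB x sub by (intro fixed_by_factors orth) auto
      then have "\<exists>y\<in>L \<inter> fixed_space C. y \<noteq> 0" using x(2,3) by blast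
      then show False using LC0 by (simp flip: dim_pos_iff)
    qed
    moreover obtain x where "x \<in> L" "x \<noteq> 0"
      using dimL dim_pos_iff[of L] by auto
    ultimately show ?thesis by (metis mem_fixed_space subsetD)
  qed
qed

section \<open>From matrices to groups of bijections of the sphere\<close>

text \<open>
  A subgroup of the group of bijections is pulled back to the set of matrices that induce its
  elements.  Closure of this set under multiplication is the only trace of the group structure
  in the hypothesis \<open>common\<close>.
\<close>

lemma fixating_restrict_matrices:
  fixes P :: "real ^ 'n ^ 'n \<Rightarrow> bool"
  assumes subgroup: "subgroup {restrict ((*v) A) \<S> | A. P A} (BijGroup \<S>)"
    and orth: "\<And>A. P A \<Longrightarrow> orthogonal_matrix A"
    and mult: "\<And>A B. P A \<Longrightarrow> P B \<Longrightarrow> P (A ** B)"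
    and common: "\<And>M. (\<And>A. A \<in> M \<Longrightarrow> P A) \<Longrightarrow> (\<And>A B. A \<in> M \<Longrightarrow> B \<in> M \<Longrightarrow> A ** B \<in> M)
      \<Longrightarrow> (\<And>A. A \<in> M \<Longrightarrow> dim (fixed_space A) > 0) \<Longrightarrow> \<exists>x. x \<noteq> 0 \<and> (\<forall>A\<in>M. A *v x = x)"
  shows "fixating \<S> {restrict ((*v) A) \<S> | A. P A}"
  unfolding fixating_def
proof (intro conjI allI impI subgroup)
  fix H assume H: "subgroup H (BijGroup \<S>\<lparr>carrier := {restrict ((*v) A) \<S> | A. P A}\<rparr>)"
    and gaf: "GAF \<S> H"
  have sub: "H \<subseteq> {restrict ((*v) A) \<S> | A. P A}" using subgroup.subset[OF H] by simp
  define M where "M = {A. P A \<and> restrict ((*v) A) \<S> \<in> H}"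
  have "\<exists>x. x \<noteq> 0 \<and> (\<forall>A\<in>M. A *v x = x)"
  proof (rule common)
    fix A B assume AB: "A \<in> M" "B \<in> M"
    have bij: "restrict ((*v) C) \<S> \<in> Bij \<S>" if "C \<in> M" for C
      using restrict_orthogonal_in_Isom_sphere[of C] orth that
      by (simp add: Isom_sphere_def isometries_def M_def)
    have "B *v x \<in> \<S>" if "x \<in> \<S>" for x
      using Bij_imp_funcset[OF bij[OF AB(2)]] that by (auto simp: Pi_iff)
    then have "restrict ((*v) A) \<S> \<otimes>\<^bsub>BijGroup \<S>\<^esub> restrict ((*v) B) \<S> = restrict ((*v) (A ** B)) \<S>"
      using bij[OF AB(1)] bij[OF AB(2)]
      by (auto simp: BijGroup_def compose_def fun_eq_iff restrict_def matrix_vector_mul_assoc)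
    then show "A ** B \<in> M"
      using AB mult subgroup.m_closed[of H "BijGroup \<S>" "restrict ((*v) A) \<S>" "restrict ((*v) B) \<S>"] gaf
      by (simp add: M_def GAF_def)
  next
    fix A assume "A \<in> M"
    then have "Fix \<S> (restrict ((*v) A) \<S>) \<noteq> {}" using gaf by (simp add: M_def GAF_def)
    then obtain x where "x \<in> \<S>" "A *v x = x" by (auto simp: Fix_def)
    then have "x \<in> fixed_space A" "x \<noteq> 0" by auto
    then show "dim (fixed_space A) > 0" unfolding dim_pos_iff by blast
  qed (simp add: M_def)
  then obtain x where x: "x \<noteq> 0" "\<And>A. A \<in> M \<Longrightarrow> A *v x = x" by blast
  have "x /\<^sub>R norm x \<in> Fix \<S> g" if g: "g \<in> H" for g
  proof -
    obtain A where "g = restrict ((*v) A) \<S>" "A \<in> M" using g sub by (auto simp: M_def)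
    then show ?thesis using x by (simp add: Fix_def matrix_vector_mult_scaleR)
  qed
  then show "GAG \<S> H" using gaf by (auto simp: GAG_def GAF_def)
qed

lemma fixatingD:
  assumes "fixating X G" "GAF X H" "H \<subseteq> G"
  shows "GAG X H"
proof -
  have "subgroup H (BijGroup X\<lparr>carrier := G\<rparr>)"
    using assms by (intro group.subgroup_incl group_BijGroup) (auto simp: fixating_def GAF_def)
  then show ?thesis using assms by (simp add: fixating_def)
qed

lemma fixating_subgroup:
  assumes "fixating X G" "subgroup G' (BijGroup X)" "G' \<subseteq> G"
  shows "fixating X G'"
  unfolding fixating_def
proof (intro conjI allI impI assms(2))
  fix H assume "subgroup H (BijGroup X\<lparr>carrier := G'\<rparr>)" "GAF X H"
  then show "GAG X H"
    using fixatingD[OF assms(1)] subgroup.subset assms(3) by fastforce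
qed

section \<open>Klein four-groups of sign matrices\<close>

text \<open>The \<open>i\<close>-th diagonal entry depends only on the colour \<open>c i\<close> of the coordinate \<open>i\<close>.\<close>

definition sign_matrix :: "('n \<Rightarrow> nat) \<Rightarrow> (nat \<Rightarrow> real) \<Rightarrow> real ^ 'n ^ 'n" where
  "sign_matrix c e = (\<chi> i j. if i = j then e (c i) else 0)"

text \<open>
  On the three colours \<open>0\<close>, \<open>1\<close>, \<open>2\<close>, these functions form the Klein four-group under pointwise
  multiplication, the value at each colour being one of the three nontrivial characters.
\<close>

definition klein_signs :: "(nat \<Rightarrow> real) set" where
  "klein_signs = {e. (\<forall>k. e k \<in> {1, -1}) \<and> e 0 * e 1 * e 2 = 1}"

lemma sign_matrix_vector: "(sign_matrix c e *v x) $ i = e (c i) * x $ i"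
  by (simp add: sign_matrix_def matrix_vector_mult_def if_distrib[of "\<lambda>c. c * _"] cong: if_cong)

lemma sign_matrix_mult: "sign_matrix c e ** sign_matrix c f = sign_matrix c (\<lambda>k. e k * f k)"
  by (simp add: matrix_eq vec_eq_iff sign_matrix_vector matrix_vector_mul_assoc[symmetric])

lemma transpose_sign_matrix: "transpose (sign_matrix c e) = sign_matrix c e"
  by (auto simp: transpose_def sign_matrix_def vec_eq_iff)

lemma sign_matrix_one: "sign_matrix c (\<lambda>_. 1) = mat 1"
  by (simp add: sign_matrix_def mat_def)

lemma det_sign_matrix: "det (sign_matrix c e) = (\<Prod>i\<in>UNIV. e (c i))"
  by (subst det_diagonal) (auto simp: sign_matrix_def)

lemma klein_signs_square: "e \<in> klein_signs \<Longrightarrow> e k * e k = 1"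
  by (auto simp: klein_signs_def) (metis mult_1 mult_minus1 minus_minus)

lemma orthogonal_sign_matrix:
  "e \<in> klein_signs \<Longrightarrow> orthogonal_matrix (sign_matrix c e)"
  by (simp add: orthogonal_matrix transpose_sign_matrix sign_matrix_mult klein_signs_square
      sign_matrix_one)

text \<open>
  Three signs with product \<open>1\<close> are not all negative, so each matrix fixes a coordinate axis.  For
  each colour, some choice of signs is negative there, so a common fixed vector has no nonzero
  coordinate.
\<close>

lemma not_fixating_klein:
  fixes c :: "'n::finite \<Rightarrow> nat" and G :: "(real ^ 'n \<Rightarrow> real ^ 'n) set"
  assumes range: "range c = {0, 1, 2}"
    and G: "\<And>e. e \<in> klein_signs \<Longrightarrow> restrict ((*v) (sign_matrix c e)) \<S> \<in> G"
  shows "\<not> fixating \<S> G"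
proof
  assume fixating: "fixating \<S> G"
  define H where "H = {restrict ((*v) A) \<S> | A. \<exists>e\<in>klein_signs. A = sign_matrix c e}"
  have "subgroup H (BijGroup \<S>)"
    unfolding H_def
  proof (rule subgroup_restrict_matrices)
    have "(\<lambda>_. 1) \<in> klein_signs" by (simp add: klein_signs_def)
    then show "\<exists>e\<in>klein_signs. mat 1 = sign_matrix c e" using sign_matrix_one by metis
    fix A B
    assume "\<exists>e\<in>klein_signs. A = sign_matrix c e" "\<exists>e\<in>klein_signs. B = sign_matrix c e"
    then obtain e f where ef: "e \<in> klein_signs" "f \<in> klein_signs"
      "A = sign_matrix c e" "B = sign_matrix c f" by blast
    have "(e 0 * f 0) * (e 1 * f 1) * (e 2 * f 2) = (e 0 * e 1 * e 2) * (f 0 * f 1 * f 2)"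
      by (simp only: mult_ac)
    also have "\<dots> = 1" using ef(1,2) by (simp add: klein_signs_def)
    finally have "(e 0 * f 0) * (e 1 * f 1) * (e 2 * f 2) = 1" .
    moreover have "e k * f k \<in> {1, -1}" for k
    proof -
      have "e k \<in> {1, -1}" "f k \<in> {1, -1}" using ef(1,2) by (simp_all add: klein_signs_def)
      then show ?thesis by auto
    qed
    ultimately have "(\<lambda>k. e k * f k) \<in> klein_signs"
      using ef(1,2) by (simp add: klein_signs_def)
    then show "\<exists>e\<in>klein_signs. A ** B = sign_matrix c e"
      using ef sign_matrix_mult by metis
  qed (auto simp: orthogonal_sign_matrix transpose_sign_matrix)
  moreover have "Fix \<S> g \<noteq> {}" if "g \<in> H" for g
  proof -
    obtain e where e: "e \<in> klein_signs" "g = restrict ((*v) (sign_matrix c e)) \<S>"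
      using \<open>g \<in> H\<close> by (auto simp: H_def)
    have "\<exists>k\<in>{0, 1, 2}. e k = 1"
    proof (rule ccontr)
      assume "\<not> ?thesis"
      then have "e 0 = -1" "e 1 = -1" "e 2 = -1" using e(1) by (auto simp: klein_signs_def)
      then show False using e(1) by (simp add: klein_signs_def)
    qed
    then obtain i where "e (c i) = 1" using range by (metis imageE)
    then have "sign_matrix c e *v axis i 1 = axis i 1"
      by (auto simp: vec_eq_iff sign_matrix_vector axis_def)
    then have "axis i 1 \<in> Fix \<S> g" by (simp add: Fix_def e(2))
    then show ?thesis by blast
  qed
  ultimately have "GAF \<S> H" by (simp add: GAF_def)
  moreover have "H \<subseteq> G" using G by (auto simp: H_def)
  ultimately have "GAG \<S> H" by (rule fixatingD[OF fixating])
  then obtain x where x: "\<And>g. g \<in> H \<Longrightarrow> x \<in> Fix \<S> g" by (auto simp: GAG_def)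
  have x0: "e (c i) * x $ i = x $ i" if "e \<in> klein_signs" for e i
  proof -
    have "x \<in> Fix \<S> (restrict ((*v) (sign_matrix c e)) \<S>)"
      using that by (intro x) (auto simp: H_def)
    then show ?thesis by (metis (mono_tags, lifting) Fix_def mem_Collect_eq restrict_apply' sign_matrix_vector)
  qed
  have "x $ i = 0" for i
  proof -
    \<comment> \<open>Negate the colour of \<open>i\<close> together with one other colour \<open>l\<close>, to keep the product \<open>1\<close>.\<close>
    define l :: nat where "l = (if c i = 0 then 1 else 0)"
    have "c i \<in> {0, 1, 2}" using range by blast
    then have "(\<lambda>k. if k = c i \<or> k = l then -1 else 1) \<in> klein_signs"
      by (auto simp: klein_signs_def l_def)
    from x0[OF this, of i] show ?thesis by simp
  qed
  then have "x = 0" by (simp add: vec_eq_iff)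
  moreover have "x \<in> \<S>"
    using x[of "\<one>\<^bsub>BijGroup \<S>\<^esub>"] subgroup.one_closed[of H "BijGroup \<S>"] \<open>GAF \<S> H\<close>
    by (auto simp: GAF_def Fix_def)
  ultimately show False by simp
qed

lemma ex_bij_lessThan_CARD:
  obtains h :: "'n::finite \<Rightarrow> nat" where "bij_betw h UNIV {..<CARD('n)}"
  using ex_bij_betw_finite_nat[of "UNIV :: 'n set"] by (auto simp: lessThan_atLeast0)

lemma not_fixating_Isom_sphere:
  assumes "CARD('n::finite) \<ge> 3"
  shows "\<not> fixating (\<S> :: (real ^ 'n) set) Isom_sphere"
proof -
  obtain h :: "'n \<Rightarrow> nat" where h: "bij_betw h UNIV {..<CARD('n)}"
    by (rule ex_bij_lessThan_CARD)
  have "range (\<lambda>i. min (h i) 2) = (\<lambda>k. min k 2) ` {..<CARD('n)}"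
    by (simp only: bij_betw_imp_surj_on[OF h, symmetric] image_image)
  also have "\<dots> = {0, 1, 2}"
  proof (intro equalityI subsetI)
    fix k :: nat assume "k \<in> {0, 1, 2}"
    then show "k \<in> (\<lambda>k. min k 2) ` {..<CARD('n)}"
      using assms by (intro image_eqI[of _ _ k]) auto
  qed auto
  finally show ?thesis
    by (rule not_fixating_klein) (simp add: restrict_orthogonal_in_Isom_sphere orthogonal_sign_matrix)
qed

text \<open>
  Colours \<open>0\<close> and \<open>1\<close> are given to \<open>s\<close> coordinates each and colour \<open>2\<close> to the others.  With
  \<open>s = 1\<close> for an odd number of coordinates and \<open>s = 2\<close> for an even one, the number of coordinates of
  colour \<open>2\<close> differs from \<open>s\<close> by an even number, so the determinant is a power of the product of
  the three signs.  For four coordinates colour \<open>2\<close> would not occur.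
\<close>

lemma not_fixating_Isom_plus_sphere:
  assumes "CARD('n::finite) \<ge> 3" "CARD('n) \<noteq> 4"
  shows "\<not> fixating (\<S> :: (real ^ 'n) set) Isom_plus_sphere"
proof -
  obtain h :: "'n \<Rightarrow> nat" where h: "bij_betw h UNIV {..<CARD('n)}"
    by (rule ex_bij_lessThan_CARD)
  define s :: nat where "s = (if odd CARD('n) then 1 else 2)"
  have s: "2 * s < CARD('n)" "s > 0" "even (CARD('n) - 3 * s)" "3 * s \<le> CARD('n)"
    using assms by (auto simp: s_def elim!: oddE evenE)
  define q where "q k = min (k div s) 2" for k
  have "range (\<lambda>i. q (h i)) = q ` {..<CARD('n)}"
    by (simp only: bij_betw_imp_surj_on[OF h, symmetric] image_image)
  also have "\<dots> = {0, 1, 2}"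
  proof (intro equalityI subsetI)
    fix k :: nat assume "k \<in> {0, 1, 2}"
    then show "k \<in> q ` {..<CARD('n)}"
      using s by (intro image_eqI[of _ _ "k * s"]) (auto simp: q_def)
  qed (auto simp: q_def)
  finally show ?thesis
  proof (rule not_fixating_klein)
    fix e :: "nat \<Rightarrow> real" assume e: "e \<in> klein_signs"
    have "det (sign_matrix (\<lambda>i. q (h i)) e) = (\<Prod>k<CARD('n). e (q k))"
      unfolding det_sign_matrix using prod.reindex_bij_betw[OF h, of "\<lambda>k. e (q k)"] by simp
    also have "{..<CARD('n)} = {..<s} \<union> {s..<2 * s} \<union> {2 * s..<CARD('n)}"
      using s by auto
    also have "(\<Prod>k\<in>{..<s} \<union> {s..<2 * s} \<union> {2 * s..<CARD('n)}. e (q k)) =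
        (\<Prod>k\<in>{..<s}. e (q k)) * (\<Prod>k\<in>{s..<2 * s}. e (q k)) * (\<Prod>k\<in>{2 * s..<CARD('n)}. e (q k))"
      by (subst prod.union_disjoint, simp, simp, fastforce)+ simp
    also have "(\<Prod>k\<in>{..<s}. e (q k)) = e 0 ^ s" by (simp add: q_def)
    also have "(\<Prod>k\<in>{s..<2 * s}. e (q k)) = (\<Prod>k\<in>{s..<2 * s}. e 1)"
    proof (intro prod.cong refl)
      fix k assume "k \<in> {s..<2 * s}"
      then have "k div s = 1" by (intro div_nat_eqI) auto
      then show "e (q k) = e 1" by (simp add: q_def)
    qed
    also have "(\<Prod>k\<in>{2 * s..<CARD('n)}. e (q k)) = (\<Prod>k\<in>{2 * s..<CARD('n)}. e 2)"
      using s(2) by (intro prod.cong) (auto simp: q_def less_eq_div_iff_mult_less_eq min_absorb2)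
    also have "\<dots> = e 2 ^ s * e 2 ^ (CARD('n) - 3 * s)"
      using s(4) by (simp flip: power_add)
    also have "e 2 ^ (CARD('n) - 3 * s) = 1"
    proof -
      obtain m where "CARD('n) - 3 * s = 2 * m" using s(3) by (rule evenE)
      then show ?thesis
        using klein_signs_square[OF e, of 2] by (simp add: power_mult power2_eq_square)
    qed
    also have "e 0 ^ s * (\<Prod>k\<in>{s..<2 * s}. e 1) * (e 2 ^ s * 1) = (e 0 * e 1 * e 2) ^ s"
      by (simp add: power_mult_distrib)
    also have "\<dots> = 1" using e by (simp add: klein_signs_def)
    finally show "restrict ((*v) (sign_matrix (\<lambda>i. q (h i)) e)) \<S> \<in> Isom_plus_sphere"
      using orthogonal_sign_matrix[OF e] by (auto simp: Isom_plus_sphere_def rotation_matrix_def)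
  qed
qed

lemma fixating_Isom_sphere:
  assumes "CARD('n::finite) = 2"
  shows "fixating (\<S> :: (real ^ 'n) set) Isom_sphere"
  unfolding Isom_sphere_eq
  using subgroup_Isom_sphere[where 'n = 'n]
  by (intro fixating_restrict_matrices common_fixed_vector_dim2 assms)
    (auto simp: Isom_sphere_eq orthogonal_matrix_mul)

lemma fixating_Isom_plus_sphere:
  assumes "CARD('n::finite) = 4"
  shows "fixating (\<S> :: (real ^ 'n) set) Isom_plus_sphere"
  unfolding Isom_plus_sphere_def
  using subgroup_Isom_plus_sphere[where 'n = 'n]
  by (intro fixating_restrict_matrices common_fixed_vector_dim4 assms)
    (auto simp: Isom_plus_sphere_def rotation_matrix_def orthogonal_matrix_mul det_mul)

theorem theorem5p16:
  fixes n :: nat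
  assumes "n \<ge> 1" and "CARD('n::finite) = n + 1"
  shows "(fixating (\<S> :: (real ^ 'n) set) Isom_sphere \<longleftrightarrow> n = 1) \<and>
         (fixating (\<S> :: (real ^ 'n) set) Isom_plus_sphere \<longleftrightarrow> n = 1 \<or> n = 3)"
proof (cases "n = 1")
  case True
  then have "fixating (\<S> :: (real ^ 'n) set) Isom_sphere"
    using assms(2) by (intro fixating_Isom_sphere) simp
  moreover from this have "fixating (\<S> :: (real ^ 'n) set) Isom_plus_sphere"
    by (rule fixating_subgroup) (rule subgroup_Isom_plus_sphere Isom_plus_sphere_subset)+
  ultimately show ?thesis using True by simp
next
  case False
  then have "CARD('n) \<ge> 3" using assms by simp
  moreover have "fixating (\<S> :: (real ^ 'n) set) Isom_plus_sphere" if "n = 3"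
    using assms(2) that by (intro fixating_Isom_plus_sphere) simp
  ultimately show ?thesis
    using False assms(2) not_fixating_Isom_sphere[where 'n = 'n]
      not_fixating_Isom_plus_sphere[where 'n = 'n] by auto
qed

end
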